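(* Let $n\ge 1$ and $\lambda\in\Lambda_{\leq n}$. For every $L\in\tau_n^\lambda$ with corresponding Gelfand--Tsetlin vector $v_L\in V_n^\lambda$, and every $1\le i\le n$, we have $$X_i v_L=\begin{cases} v_L & \text{if } i\in L,\\ 0 & \text{otherwise,}\end{cases}\qquad\text{and}\qquad \tilde X_i v_L=\begin{cases}\mathrm{ct}(L(i))\,v_L & \text{if } i\in L,\\ 0 & \text{otherwise.}\end{cases}$$
   Context: $R_n$ (the rook monoid) is the monoid, under matrix multiplication, of all $n\times n$ matrices with entries in $\{0,1\}$ having at most one nonzero entry in each row and each column; $\mathbb{C}R_n$ is its monoid algebra. $(a,b)$ denotes the permutation matrix of the transposition of $a$ and $b$ (the identity if $a=b$), $s_i=(i,i+1)$ for $1\le i\le n-1$, and $P_j\in R_n$ is the diagonal matrix whose first $j$ diagonal entries are $0$ and whose other diagonal entries are $1$. $\mathbb{C}R_n$ is generated by $s_1,\dots,s_{n-1},P_1$. Elements of $\mathbb{C}R_n$: $X_1=1-P_1$ and $X_i=s_{i-1}X_{i-1}s_{i-1}$ for $2\le i\le n$; $\gamma_i=1-X_i$ for $1\le i\le n$; $Q_i=(2,i-1)(1,i)P_2(1,i)(2,i-1)$ for $2\le i\le n$; $\tilde X_1=0$ and $$\tilde X_i=s_{i-1}\tilde X_{i-1}s_{i-1}+s_{i-1}-s_{i-1}\gamma_{i-1}-\gamma_{i-1}s_{i-1}+Q_i\quad(2\le i\le n).$$ $\Lambda_{\leq n}$ is the set of all partitions (Young diagrams) of $r$ with $0\le r\le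 n$. For $\lambda\in\Lambda_{\leq n}$, an $n$-standard tableau of shape $\lambda$ is a filling of the boxes of $\lambda$ with entries from $\{1,\dots,n\}$ strictly increasing along rows from left to right and along columns from top to bottom; $\tau_n^\lambda$ is the set of these. Write $i\in L$ if $i$ is an entry of $L$, and $L(i)$ for the box containing $i$. The content of the box in row $x$, column $y$ is $\mathrm{ct}=y-x$. $s_iL$ denotes the filling obtained from $L$ by replacing $i$ by $i+1$ (if $i\in L$) and $i+1$ by $i$ (if $i+1\in L$). $V_n^\lambda$ is the $\mathbb{C}$-vector space with basis $\{v_L\mid L\in\tau_n^\lambda\}$ and $\mathbb{C}R_n$-action given by: $s_iv_L=v_{s_iL}$ if exactly one of $i,i+1$ is in $L$; $s_iv_L=v_L$ if neither is in $L$; and if both $i,i+1\in L$, $s_iv_L=a_{L(i)}v_L+(1+a_{L(i)})v_{L'}$ with $a_{L(i)}=\frac{1}{\mathrm{ct}(L(i+1))-\mathrm{ct}(L(i))}$ and $v_{L'}=v_{s_iL}$ if $s_iL\in\tau_n^\lambda$, $v_{L'}=0$ otherwise; $P_1v_L=v_L$ if $1\notin L$ and $P_1v_L=0$ otherwise. The $V_n^\lambda$, $\lambda\in\Lambda_{\leq n}$, form a complete set of pairwise nonisomorphic irreducible representations of $\mathbb{C}R_n$, and $\{v_L\}$ is the Gelfand--Tsetlin basis of $V_n^\lambda$. *)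

theory Defs
  imports
    "Jordan_Normal_Form.Matrix"
    "HOL-Library.Poly_Mapping"
    "HOL-Combinatorics.Transposition"
    "HOL-Library.FuncSet"
begin

section \<open>The rook monoid and its monoid algebra\<close>

definition rook_monoid :: "nat \<Rightarrow> int mat set" where
  "rook_monoid n = {A \<in> carrier_mat n n.
     (\<forall>r<n. \<forall>c<n. A $$ (r, c) \<in> {0, 1}) \<and>
     (\<forall>r<n. card {c. c < n \<and> A $$ (r, c) \<noteq> 0} \<le> 1) \<and>
     (\<forall>c<n. card {r. r < n \<and> A $$ (r, c) \<noteq> 0} \<le> 1)}"

text \<open>The indices \<open>a, b, j\<close> below are 1-based, as in the mathematics; matrix positions are 0-based.\<close>

definition transp_mat :: "nat \<Rightarrow> nat \<Rightarrow> nat \<Rightarrow> int mat" where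
  "transp_mat n a b =
     mat n n (\<lambda>(r, c). if Suc r = Transposition.transpose a b (Suc c) then 1 else 0)"

definition proj_mat :: "nat \<Rightarrow> nat \<Rightarrow> int mat" where
  "proj_mat n j = mat n n (\<lambda>(r, c). if r = c \<and> j < Suc r then 1 else 0)"

text \<open>Finitely supported functions serve as formal complex linear combinations. The type class
  multiplication on them is convolution with respect to \<^emph>\<open>addition\<close> of keys,
  so the product of the monoid algebra is defined separately. All matrices of the type share one product;
  the algebra of the rook monoid is the set of combinations supported on it.\<close>

definition lin_scale :: "complex \<Rightarrow> ('a \<Rightarrow>\<^sub>0 complex) \<Rightarrow> ('a \<Rightarrow>\<^sub>0 complex)" where
  "lin_scale c f = Poly_Mapping.map (\<lambda>z. c * z) f"

definition alg_mult :: "(int mat \<Rightarrow>\<^sub>0 complex) \<Rightarrow> (int mat \<Rightarrow>\<^sub>0 complex) \<Rightarrow> (int mat \<Rightarrow>\<^sub>0 complex)"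
    (infixl "\<star>" 70) where
  "f \<star> g = (\<Sum>A \<in> Poly_Mapping.keys f. \<Sum>B \<in> Poly_Mapping.keys g.
     Poly_Mapping.single (A * B) (Poly_Mapping.lookup f A * Poly_Mapping.lookup g B))"

definition rook_algebra :: "nat \<Rightarrow> (int mat \<Rightarrow>\<^sub>0 complex) set" where
  "rook_algebra n = {f. Poly_Mapping.keys f \<subseteq> rook_monoid n}"

definition alg_one :: "nat \<Rightarrow> (int mat \<Rightarrow>\<^sub>0 complex)" where
  "alg_one n = Poly_Mapping.single (1\<^sub>m n) 1"

definition alg_transp :: "nat \<Rightarrow> nat \<Rightarrow> nat \<Rightarrow> (int mat \<Rightarrow>\<^sub>0 complex)" where
  "alg_transp n a b = Poly_Mapping.single (transp_mat n a b) 1"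

definition alg_s :: "nat \<Rightarrow> nat \<Rightarrow> (int mat \<Rightarrow>\<^sub>0 complex)" where
  "alg_s n i = alg_transp n i (i + 1)"

definition alg_P :: "nat \<Rightarrow> nat \<Rightarrow> (int mat \<Rightarrow>\<^sub>0 complex)" where
  "alg_P n j = Poly_Mapping.single (proj_mat n j) 1"


section \<open>Jucys--Murphy elements\<close>

text \<open>The value at index 0 is junk: these families are indexed by \<open>1, \<dots>, n\<close>.\<close>

fun JM_X :: "nat \<Rightarrow> nat \<Rightarrow> (int mat \<Rightarrow>\<^sub>0 complex)" where
  "JM_X n 0 = 0"
| "JM_X n (Suc 0) = alg_one n - alg_P n 1"
| "JM_X n (Suc (Suc k)) = alg_s n (Suc k) \<star> JM_X n (Suc k) \<star> alg_s n (Suc k)"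

definition JM_gamma :: "nat \<Rightarrow> nat \<Rightarrow> (int mat \<Rightarrow>\<^sub>0 complex)" where
  "JM_gamma n i = alg_one n - JM_X n i"

definition JM_Q :: "nat \<Rightarrow> nat \<Rightarrow> (int mat \<Rightarrow>\<^sub>0 complex)" where
  "JM_Q n i = alg_transp n 2 (i - 1) \<star> alg_transp n 1 i \<star> alg_P n 2
                \<star> alg_transp n 1 i \<star> alg_transp n 2 (i - 1)"

fun JM_Xt :: "nat \<Rightarrow> nat \<Rightarrow> (int mat \<Rightarrow>\<^sub>0 complex)" where
  "JM_Xt n 0 = 0"
| "JM_Xt n (Suc 0) = 0"
| "JM_Xt n (Suc (Suc k)) =
     alg_s n (Suc k) \<star> JM_Xt n (Suc k) \<star> alg_s n (Suc k)
     + alg_s n (Suc k)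
     - alg_s n (Suc k) \<star> JM_gamma n (Suc k)
     - JM_gamma n (Suc k) \<star> alg_s n (Suc k)
     + JM_Q n (Suc (Suc k))"


section \<open>Partitions and tableaux\<close>

definition partitions_upto :: "nat \<Rightarrow> nat list set" where
  "partitions_upto n = {lam. sorted_wrt (\<ge>) lam \<and> 0 \<notin> set lam \<and> sum_list lam \<le> n}"

definition diagram :: "nat list \<Rightarrow> (nat \<times> nat) set" where
  "diagram lam = {(x, y). 1 \<le> x \<and> x \<le> length lam \<and> 1 \<le> y \<and> y \<le> lam ! (x - 1)}"

definition content :: "nat \<times> nat \<Rightarrow> int" where
  "content b = int (snd b) - int (fst b)"

type_synonym filling = "nat \<times> nat \<Rightarrow> nat"

text \<open>Entries are pairwise distinct; otherwise the box containing \<open>i\<close> would not be well defined.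
  Fillings are extensional functions on the diagram, so that equal tableaux are equal functions.\<close>

definition std_tableaux :: "nat \<Rightarrow> nat list \<Rightarrow> filling set" where
  "std_tableaux n lam = {L \<in> diagram lam \<rightarrow>\<^sub>E {1..n}.
     inj_on L (diagram lam) \<and>
     (\<forall>x y y'. (x, y) \<in> diagram lam \<and> (x, y') \<in> diagram lam \<and> y < y' \<longrightarrow> L (x, y) < L (x, y')) \<and>
     (\<forall>x x' y. (x, y) \<in> diagram lam \<and> (x', y) \<in> diagram lam \<and> x < x' \<longrightarrow> L (x, y) < L (x', y))}"

definition entries :: "nat list \<Rightarrow> filling \<Rightarrow> nat set" where
  "entries lam L = L ` diagram lam"

definition box_of :: "nat list \<Rightarrow> filling \<Rightarrow> nat \<Rightarrow> nat \<times> nat" where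
  "box_of lam L i = the_inv_into (diagram lam) L i"

definition swap_entries :: "nat list \<Rightarrow> nat \<Rightarrow> filling \<Rightarrow> filling" where
  "swap_entries lam i L = restrict (\<lambda>b. Transposition.transpose i (i + 1) (L b)) (diagram lam)"


section \<open>The module with basis indexed by tableaux\<close>

definition V_space :: "nat \<Rightarrow> nat list \<Rightarrow> (filling \<Rightarrow>\<^sub>0 complex) set" where
  "V_space n lam = {u. Poly_Mapping.keys u \<subseteq> std_tableaux n lam}"

definition basis_vec :: "filling \<Rightarrow> (filling \<Rightarrow>\<^sub>0 complex)" where
  "basis_vec L = Poly_Mapping.single L 1"

definition seminormal_coeff :: "nat list \<Rightarrow> filling \<Rightarrow> nat \<Rightarrow> complex" where
  "seminormal_coeff lam L i =
     1 / of_int (content (box_of lam L (i + 1)) - content (box_of lam L i))"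

text \<open>\<open>act\<close> is a unital action of the rook algebra on the free vector space over the
  tableaux. Since the \<open>s\<^sub>i\<close> and \<open>P\<^sub>1\<close> generate the algebra, the last four
  assumptions determine it on \<open>rook_algebra n \<times> V_space n lam\<close>.\<close>

locale rook_rep =
  fixes n :: nat and lam :: "nat list"
    and act :: "(int mat \<Rightarrow>\<^sub>0 complex) \<Rightarrow> (filling \<Rightarrow>\<^sub>0 complex) \<Rightarrow> (filling \<Rightarrow>\<^sub>0 complex)"
  assumes act_closed:
      "\<And>f u. f \<in> rook_algebra n \<Longrightarrow> u \<in> V_space n lam \<Longrightarrow> act f u \<in> V_space n lam"
    and act_add_right:
      "\<And>f u w. f \<in> rook_algebra n \<Longrightarrow> u \<in> V_space n lam \<Longrightarrow> w \<in> V_space n lam \<Longrightarrow>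
         act f (u + w) = act f u + act f w"
    and act_scale_right:
      "\<And>f c u. f \<in> rook_algebra n \<Longrightarrow> u \<in> V_space n lam \<Longrightarrow>
         act f (lin_scale c u) = lin_scale c (act f u)"
    and act_add_left:
      "\<And>f g u. f \<in> rook_algebra n \<Longrightarrow> g \<in> rook_algebra n \<Longrightarrow> u \<in> V_space n lam \<Longrightarrow>
         act (f + g) u = act f u + act g u"
    and act_scale_left:
      "\<And>c f u. f \<in> rook_algebra n \<Longrightarrow> u \<in> V_space n lam \<Longrightarrow>
         act (lin_scale c f) u = lin_scale c (act f u)"
    and act_one:
      "\<And>u. u \<in> V_space n lam \<Longrightarrow> act (alg_one n) u = u"
    and act_mult:
      "\<And>f g u. f \<in> rook_algebra n \<Longrightarrow> g \<in> rook_algebra n \<Longrightarrow> u \<in> V_space n lam \<Longrightarrow>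
         act (f \<star> g) u = act f (act g u)"
    and act_s_one_entry:
      "\<And>L i. L \<in> std_tableaux n lam \<Longrightarrow> 1 \<le> i \<Longrightarrow> i < n \<Longrightarrow>
         (i \<in> entries lam L) \<noteq> (i + 1 \<in> entries lam L) \<Longrightarrow>
         act (alg_s n i) (basis_vec L) = basis_vec (swap_entries lam i L)"
    and act_s_no_entry:
      "\<And>L i. L \<in> std_tableaux n lam \<Longrightarrow> 1 \<le> i \<Longrightarrow> i < n \<Longrightarrow>
         i \<notin> entries lam L \<Longrightarrow> i + 1 \<notin> entries lam L \<Longrightarrow>
         act (alg_s n i) (basis_vec L) = basis_vec L"
    and act_s_both_entries:
      "\<And>L i. L \<in> std_tableaux n lam \<Longrightarrow> 1 \<le> i \<Longrightarrow> i < n \<Longrightarrow>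
         i \<in> entries lam L \<Longrightarrow> i + 1 \<in> entries lam L \<Longrightarrow>
         act (alg_s n i) (basis_vec L) =
           lin_scale (seminormal_coeff lam L i) (basis_vec L) +
           lin_scale (1 + seminormal_coeff lam L i)
             (if swap_entries lam i L \<in> std_tableaux n lam
              then basis_vec (swap_entries lam i L) else 0)"
    and act_P1:
      "\<And>L. L \<in> std_tableaux n lam \<Longrightarrow>
         act (alg_P n 1) (basis_vec L) = (if 1 \<notin> entries lam L then basis_vec L else 0)"

end

theory Submission
  imports Defs
begin

text \<open>
  Both families are defined by conjugation with \<open>s\<^sub>i\<close>, so both formulas go by induction on
  the index, simultaneously for all tableaux. Everything depends on how \<open>s\<^sub>i\<close> moves \<open>v\<^sub>L\<close>.

  If \<open>i\<close> and \<open>i + 1\<close> are not both entries of \<open>L\<close>, then \<open>s\<^sub>i v\<^sub>L\<close> is the basis vector of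
  \<open>s\<^sub>i L\<close>, which is again a standard tableau (and is \<open>L\<close> itself if neither is an entry). So a
  conjugate \<open>s\<^sub>i f s\<^sub>i\<close> has at \<open>v\<^sub>L\<close> the eigenvalue that \<open>f\<close> has at \<open>s\<^sub>i L\<close>
  (\<open>act_conj_s_not_both\<close>), and what was true of \<open>i\<close> becomes true of \<open>i + 1\<close>.

  If both are entries, \<open>s\<^sub>i v\<^sub>L\<close> is a combination of \<open>v\<^sub>L\<close> and \<open>v\<^bsub>L'\<^esub>\<close>, where \<open>L'\<close> also has both
  entries. An \<open>f\<close> whose eigenvalue depends only on whether \<open>i\<close> is an entry is constant on this
  span and commutes with \<open>s\<^sub>i\<close> there (\<open>act_conj_s_indicator\<close>); this settles \<open>X\<^sub>i\<close> and
  \<open>\<gamma>\<^sub>i\<close>. For the other family, let \<open>c\<close> and \<open>d\<close> be the contents of \<open>i\<close> and \<open>i + 1\<close> in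
  \<open>L\<close>. The seminormal coefficient \<open>1 / (d - c)\<close> is exactly what makes
  \<open>X\<^sub>i s\<^sub>i v\<^sub>L = d s\<^sub>i v\<^sub>L - v\<^sub>L\<close> (with \<open>X\<^sub>i\<close> now from the second family), whence
  \<open>(s\<^sub>i X\<^sub>i s\<^sub>i + s\<^sub>i) v\<^sub>L = d v\<^sub>L\<close> as in the symmetric group, while the \<open>\<gamma>\<close> and \<open>Q\<close> terms
  kill \<open>v\<^sub>L\<close>. When the entries are not both present those terms instead cancel the
  unwanted \<open>s\<^sub>i v\<^sub>L\<close>. For this the action of \<open>Q\<close> must be known in terms of the generators:
  \<open>Q\<^bsub>i+1\<^esub>\<close> is the diagonal matrix that erases \<open>i\<close> and \<open>i + 1\<close>, a product of two matrices each of
  which is a conjugate of \<open>P\<^sub>1\<close> (\<open>JM_Q_eq_erase_mult\<close>, \<open>erase_Suc\<close>).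

  The action is only specified on the rook algebra, so one also needs that rook matrices are
  closed under products.
\<close>

section \<open>Rook matrices\<close>

lemma rook_monoid_iff:
  "A \<in> rook_monoid n \<longleftrightarrow> A \<in> carrier_mat n n \<and>
     (\<forall>r<n. \<forall>c<n. A $$ (r, c) \<in> {0, 1}) \<and>
     (\<forall>r<n. \<forall>c<n. \<forall>d<n. A $$ (r, c) \<noteq> 0 \<and> A $$ (r, d) \<noteq> 0 \<longrightarrow> c = d) \<and>
     (\<forall>c<n. \<forall>r<n. \<forall>q<n. A $$ (r, c) \<noteq> 0 \<and> A $$ (q, c) \<noteq> 0 \<longrightarrow> r = q)"
  unfolding rook_monoid_def by (auto simp: card_le_Suc0_iff_eq)

lemma transpose_mat_rook_monoid:
  "A \<in> rook_monoid n \<Longrightarrow> A\<^sup>T \<in> rook_monoid n"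
  unfolding rook_monoid_iff by (auto; blast)

lemma rook_monoid_times_row:
  assumes A: "A \<in> rook_monoid n" and B: "B \<in> carrier_mat n n" and r: "r < n"
  shows "(\<forall>c<n. (A * B) $$ (r, c) = 0) \<or> (\<exists>k<n. \<forall>c<n. (A * B) $$ (r, c) = B $$ (k, c))"
proof (cases "\<exists>k<n. A $$ (r, k) \<noteq> 0")
  case True
  then obtain k where k: "k < n" "A $$ (r, k) \<noteq> 0" by blast
  have row: "A $$ (r, j) = (if j = k then 1 else 0)" if "j < n" for j
    using A k r that unfolding rook_monoid_iff by (metis empty_iff insert_iff)
  have "(A * B) $$ (r, c) = B $$ (k, c)" if c: "c < n" for c
  proof -
    have "(A * B) $$ (r, c) = (\<Sum>j = 0..<n. A $$ (r, j) * B $$ (j, c))"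
      using A B r c by (auto simp: rook_monoid_iff scalar_prod_def)
    also have "\<dots> = (\<Sum>j = 0..<n. if j = k then B $$ (j, c) else 0)"
      by (rule sum.cong) (auto simp: row)
    also have "\<dots> = B $$ (k, c)" using k by simp
    finally show ?thesis .
  qed
  with k show ?thesis by blast
next
  case False
  then have "(A * B) $$ (r, c) = 0" if "c < n" for c
    using A B r that by (auto simp: rook_monoid_iff scalar_prod_def)
  then show ?thesis by blast
qed

text \<open>Rows of a product are rows of the right factor or zero; columns follow by transposing.\<close>

lemma rook_monoid_times:
  assumes A: "A \<in> rook_monoid n" and B: "B \<in> rook_monoid n"
  shows "A * B \<in> rook_monoid n"
proof -
  have carr: "A \<in> carrier_mat n n" "B \<in> carrier_mat n n"
    using A B by (auto simp: rook_monoid_iff)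
  have rows: "(\<forall>c<n. (C * D) $$ (r, c) \<in> {0, 1}) \<and>
      (\<forall>c<n. \<forall>d<n. (C * D) $$ (r, c) \<noteq> 0 \<and> (C * D) $$ (r, d) \<noteq> 0 \<longrightarrow> c = d)"
    if C: "C \<in> rook_monoid n" and D: "D \<in> rook_monoid n" and r: "r < n" for C D r
  proof -
    have "D \<in> carrier_mat n n" using D by (simp add: rook_monoid_iff)
    from rook_monoid_times_row[OF C this r] show ?thesis
    proof
      assume "\<exists>k<n. \<forall>c<n. (C * D) $$ (r, c) = D $$ (k, c)"
      then obtain k where k: "k < n" and eq: "\<And>c. c < n \<Longrightarrow> (C * D) $$ (r, c) = D $$ (k, c)" by blast
      then have "\<forall>c<n. D $$ (k, c) \<in> {0, 1}"
        and "\<forall>c<n. \<forall>d<n. D $$ (k, c) \<noteq> 0 \<and> D $$ (k, d) \<noteq> 0 \<longrightarrow> c = d"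
        using D k unfolding rook_monoid_iff by metis+
      then show ?thesis by (simp add: eq)
    qed simp
  qed
  have swap: "(A * B) $$ (r, c) = (B\<^sup>T * A\<^sup>T) $$ (c, r)" if "r < n" "c < n" for r c
    using carr that by (simp flip: transpose_mult[OF carr])
  note cols = rows[OF transpose_mat_rook_monoid[OF B] transpose_mat_rook_monoid[OF A]]
  show ?thesis
    unfolding rook_monoid_iff
  proof (intro conjI)
    show "A * B \<in> carrier_mat n n" using carr by simp
    show "\<forall>c<n. \<forall>r<n. \<forall>q<n. (A * B) $$ (r, c) \<noteq> 0 \<and> (A * B) $$ (q, c) \<noteq> 0 \<longrightarrow> r = q"
      using cols by (simp add: swap)
  qed (use rows[OF A B] in blast)+
qed

text \<open>The idempotents of the rook monoid: the partial identities. Like the indices of the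
  transpositions, the elements of \<open>S\<close> count from 1.\<close>

definition partial_id :: "nat \<Rightarrow> nat set \<Rightarrow> int mat" where
  "partial_id n S = mat n n (\<lambda>(r, c). if r = c \<and> Suc r \<in> S then 1 else 0)"

lemma partial_id_carrier [simp]: "partial_id n S \<in> carrier_mat n n"
  by (simp add: partial_id_def)

lemma transp_mat_carrier [simp]: "transp_mat n a b \<in> carrier_mat n n"
  by (simp add: transp_mat_def)

lemma one_mat_eq_partial_id: "1\<^sub>m n = partial_id n UNIV"
  by (rule eq_matI) (auto simp: partial_id_def)

lemma proj_mat_eq_partial_id: "proj_mat n j = partial_id n {j<..}"
  by (rule eq_matI) (auto simp: partial_id_def proj_mat_def)

lemma partial_id_rook_monoid: "partial_id n S \<in> rook_monoid n"
  by (auto simp: rook_monoid_iff partial_id_def)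

lemma transp_mat_rook_monoid: "transp_mat n a b \<in> rook_monoid n"
  unfolding rook_monoid_iff transp_mat_def
  by (auto split: if_splits)
     (metis Suc_inject transpose_involutory)

lemma partial_id_times: "partial_id n S * partial_id n T = partial_id n (S \<inter> T)"
proof (rule eq_matI)
  fix r c assume rc: "r < dim_row (partial_id n (S \<inter> T))" "c < dim_col (partial_id n (S \<inter> T))"
  then have "(partial_id n S * partial_id n T) $$ (r, c)
      = (\<Sum>j = 0..<n. partial_id n S $$ (r, j) * partial_id n T $$ (j, c))"
    by (simp add: partial_id_def scalar_prod_def)
  also have "\<dots> = (\<Sum>j = 0..<n. if j = r then (if r = c \<and> Suc r \<in> S \<inter> T then 1 else 0) else 0)"
    using rc by (intro sum.cong) (auto simp: partial_id_def)
  finally show "(partial_id n S * partial_id n T) $$ (r, c) = partial_id n (S \<inter> T) $$ (r, c)"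
    using rc by (simp add: partial_id_def)
qed (simp_all add: partial_id_def)

text \<open>Conjugation by a permutation permutes the coordinates that a partial identity keeps. Below, all
  matrix products are computed with this and \<open>partial_id_times\<close>.\<close>

lemma transp_mat_conj_partial_id:
  assumes ab: "a \<in> {1..n}" "b \<in> {1..n}"
  shows "transp_mat n a b * partial_id n S * transp_mat n a b
       = partial_id n (Transposition.transpose a b ` S)"
proof (rule eq_matI)
  let ?t = "Transposition.transpose a b"
  fix r c assume "r < dim_row (partial_id n (?t ` S))" "c < dim_col (partial_id n (?t ` S))"
  then have rc: "r < n" "c < n" by (simp_all add: partial_id_def)
  \<comment> \<open>the transposition acting on 0-based positions\<close>
  define p where "p k = ?t (Suc k) - 1" for k
  have Suc_p: "Suc (p k) = ?t (Suc k)" for k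
    using ab by (auto simp: p_def Transposition.transpose_def)
  have p_less: "p k < n" if "k < n" for k
    using ab that by (auto simp: p_def Transposition.transpose_def)
  have p_eq: "Suc k = ?t (Suc j) \<longleftrightarrow> j = p k" for k j
    by (metis Suc_inject Suc_p transpose_involutory)
  have left: "(transp_mat n a b * partial_id n S) $$ (r, j)
      = (if j = p r \<and> ?t (Suc r) \<in> S then 1 else 0)" if j: "j < n" for j
  proof -
    have "(transp_mat n a b * partial_id n S) $$ (r, j)
        = (\<Sum>k = 0..<n. transp_mat n a b $$ (r, k) * partial_id n S $$ (k, j))"
      using rc j by (simp add: partial_id_def transp_mat_def scalar_prod_def)
    also have "\<dots> = (\<Sum>k = 0..<n. if k = p r then (if k = j \<and> Suc k \<in> S then 1 else 0) else 0)"
      using rc j by (intro sum.cong) (auto simp: partial_id_def transp_mat_def p_eq)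
    also have "\<dots> = (if j = p r \<and> ?t (Suc r) \<in> S then 1 else 0)"
      using p_less rc by (auto simp: Suc_p)
    finally show ?thesis .
  qed
  have "(transp_mat n a b * partial_id n S * transp_mat n a b) $$ (r, c)
      = (\<Sum>k = 0..<n. (transp_mat n a b * partial_id n S) $$ (r, k) * transp_mat n a b $$ (k, c))"
    using rc by (simp add: scalar_prod_def partial_id_def transp_mat_def)
  also have "\<dots> = (\<Sum>k = 0..<n. if k = p r then (if ?t (Suc r) \<in> S \<and> r = c then 1 else 0) else 0)"
  proof (rule sum.cong)
    fix k assume "k \<in> {0..<n}"
    then have k: "k < n" by simp
    have "k = p r \<Longrightarrow> Suc k = ?t (Suc c) \<longleftrightarrow> r = c"
      by (metis Suc_inject Suc_p transpose_involutory)
    then show "(transp_mat n a b * partial_id n S) $$ (r, k) * transp_mat n a b $$ (k, c)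
        = (if k = p r then (if ?t (Suc r) \<in> S \<and> r = c then 1 else 0) else 0)"
      unfolding left[OF k] using k rc by (auto simp: transp_mat_def)
  qed simp
  also have "\<dots> = (if ?t (Suc r) \<in> S \<and> r = c then 1 else 0)"
    using p_less rc by simp
  also have "?t (Suc r) \<in> S \<longleftrightarrow> Suc r \<in> ?t ` S"
    by (metis image_iff transpose_involutory)
  finally show "(transp_mat n a b * partial_id n S * transp_mat n a b) $$ (r, c)
      = partial_id n (?t ` S) $$ (r, c)"
    using rc by (auto simp: partial_id_def)
qed (simp_all add: partial_id_def transp_mat_def)

lemma transp_mat_involution:
  assumes "a \<in> {1..n}" "b \<in> {1..n}"
  shows "transp_mat n a b * transp_mat n a b = 1\<^sub>m n"
  using transp_mat_conj_partial_id[OF assms, of UNIV]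
  by (simp flip: one_mat_eq_partial_id add: right_mult_one_mat[OF transp_mat_carrier])


section \<open>The monoid algebra\<close>

lemma alg_mult_single:
  "Poly_Mapping.single A a \<star> Poly_Mapping.single B b = Poly_Mapping.single (A * B) (a * b)"
  by (cases "a = 0"; cases "b = 0") (auto simp: alg_mult_def)

lemma lookup_lin_scale [simp]:
  "Poly_Mapping.lookup (lin_scale c f) k = c * Poly_Mapping.lookup f k"
  by (simp add: lin_scale_def Poly_Mapping.map.rep_eq when_def)

lemma lin_scale_simps [simp]:
  "lin_scale 1 f = f" "lin_scale 0 f = 0" "lin_scale c 0 = 0"
  by (rule poly_mapping_eqI; simp)+

lemma diff_eq_add_lin_scale: "f - g = f + lin_scale (- 1) g"
  by (rule poly_mapping_eqI) (simp add: lookup_add lookup_minus)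

lemma keys_lin_scale: "Poly_Mapping.keys (lin_scale c f) \<subseteq> Poly_Mapping.keys f"
  by (auto simp: in_keys_iff)

lemma single_rook_algebra:
  "A \<in> rook_monoid n \<Longrightarrow> Poly_Mapping.single A a \<in> rook_algebra n"
  by (auto simp: rook_algebra_def)

lemma zero_rook_algebra: "0 \<in> rook_algebra n"
  by (simp add: rook_algebra_def)

lemma add_rook_algebra:
  "f \<in> rook_algebra n \<Longrightarrow> g \<in> rook_algebra n \<Longrightarrow> f + g \<in> rook_algebra n"
  using keys_add[of f g] by (auto simp: rook_algebra_def)

lemma lin_scale_rook_algebra: "f \<in> rook_algebra n \<Longrightarrow> lin_scale c f \<in> rook_algebra n"
  using keys_lin_scale[of c f] by (auto simp: rook_algebra_def)

lemma diff_rook_algebra: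
  "f \<in> rook_algebra n \<Longrightarrow> g \<in> rook_algebra n \<Longrightarrow> f - g \<in> rook_algebra n"
  by (simp add: diff_eq_add_lin_scale add_rook_algebra lin_scale_rook_algebra)

lemma sum_rook_algebra:
  "(\<And>x. x \<in> S \<Longrightarrow> f x \<in> rook_algebra n) \<Longrightarrow> sum f S \<in> rook_algebra n"
  by (induction S rule: infinite_finite_induct)
     (auto intro: zero_rook_algebra add_rook_algebra)

lemma mult_rook_algebra:
  "f \<in> rook_algebra n \<Longrightarrow> g \<in> rook_algebra n \<Longrightarrow> f \<star> g \<in> rook_algebra n"
  unfolding alg_mult_def
  by (intro sum_rook_algebra single_rook_algebra rook_monoid_times)
     (auto simp: rook_algebra_def)

lemma alg_one_rook_algebra: "alg_one n \<in> rook_algebra n"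
  by (simp add: alg_one_def one_mat_eq_partial_id single_rook_algebra partial_id_rook_monoid)

lemma alg_P_rook_algebra: "alg_P n j \<in> rook_algebra n"
  by (simp add: alg_P_def proj_mat_eq_partial_id single_rook_algebra partial_id_rook_monoid)

lemma alg_transp_rook_algebra: "alg_transp n a b \<in> rook_algebra n"
  by (simp add: alg_transp_def single_rook_algebra transp_mat_rook_monoid)

lemma alg_s_rook_algebra: "alg_s n i \<in> rook_algebra n"
  by (simp add: alg_s_def alg_transp_rook_algebra)

lemma JM_X_rook_algebra: "JM_X n i \<in> rook_algebra n"
  by (induction n i rule: JM_X.induct)
     (auto intro!: zero_rook_algebra diff_rook_algebra mult_rook_algebra
        alg_one_rook_algebra alg_P_rook_algebra alg_s_rook_algebra)

lemma JM_gamma_rook_algebra: "JM_gamma n i \<in> rook_algebra n"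
  by (simp add: JM_gamma_def diff_rook_algebra alg_one_rook_algebra JM_X_rook_algebra)

lemma JM_Q_rook_algebra: "JM_Q n i \<in> rook_algebra n"
  unfolding JM_Q_def by (intro mult_rook_algebra alg_transp_rook_algebra alg_P_rook_algebra)

lemma JM_Xt_rook_algebra: "JM_Xt n i \<in> rook_algebra n"
  by (induction n i rule: JM_Xt.induct)
     (auto intro!: zero_rook_algebra add_rook_algebra diff_rook_algebra mult_rook_algebra
        alg_s_rook_algebra JM_gamma_rook_algebra JM_Q_rook_algebra)

lemmas rook_algebra_intros =
  zero_rook_algebra add_rook_algebra diff_rook_algebra lin_scale_rook_algebra mult_rook_algebra
  alg_one_rook_algebra alg_P_rook_algebra alg_s_rook_algebra JM_X_rook_algebra
  JM_gamma_rook_algebra JM_Q_rook_algebra JM_Xt_rook_algebra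

lemma alg_s_involution:
  assumes "1 \<le> i" "i < n"
  shows "alg_s n i \<star> alg_s n i = alg_one n"
  using assms by (simp add: alg_s_def alg_transp_def alg_one_def alg_mult_single transp_mat_involution)

text \<open>For \<open>1 \<le> i \<le> n\<close> this is \<open>\<gamma>\<^sub>i\<close>, written as a single element of the monoid. In this form
  it can be multiplied as a matrix, which exhibits the \<open>Q\<close> elements as products.\<close>

definition erase :: "nat \<Rightarrow> nat \<Rightarrow> (int mat \<Rightarrow>\<^sub>0 complex)" where
  "erase n i = Poly_Mapping.single (partial_id n (- {i})) 1"

lemma erase_rook_algebra: "erase n i \<in> rook_algebra n"
  by (simp add: erase_def single_rook_algebra partial_id_rook_monoid)

lemma partial_id_cong: "S \<inter> {1..n} = T \<inter> {1..n} \<Longrightarrow> partial_id n S = partial_id n T"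
  by (rule eq_matI) (simp_all add: partial_id_def set_eq_iff, metis Suc_leI zero_less_Suc One_nat_def Suc_le_mono le0)

lemma erase_1: "erase n 1 = alg_P n 1"
  unfolding erase_def alg_P_def proj_mat_eq_partial_id
  by (rule arg_cong[where f = "\<lambda>A. Poly_Mapping.single A 1"], rule partial_id_cong) auto

lemma erase_Suc:
  assumes "1 \<le> i" "i < n"
  shows "erase n (Suc i) = alg_s n i \<star> erase n i \<star> alg_s n i"
proof -
  have "Transposition.transpose i (i + 1) ` (- {i}) = - {Suc i}"
    by (simp add: bij_image_Compl_eq[OF bij_transpose])
  then show ?thesis
    using assms by (simp add: erase_def alg_s_def alg_transp_def alg_mult_single
        transp_mat_conj_partial_id)
qed

text \<open>The two conjugations carry the erased set \<open>{1, 2}\<close> first to \<open>{i + 1, 2}\<close> and then to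
  \<open>{i + 1, i}\<close>; for \<open>i = 1\<close> each of them merely swaps its two elements.\<close>

lemma JM_Q_eq_erase_mult:
  assumes "1 \<le> i" "i < n"
  shows "JM_Q n (Suc i) = erase n i \<star> erase n (Suc i)"
proof -
  let ?S = "transp_mat n 1 (Suc i)" and ?T = "transp_mat n 2 i" and ?D = "partial_id n (- {1, 2})"
  have mem: "1 \<in> {1..n}" "Suc i \<in> {1..n}" "2 \<in> {1..n}" "i \<in> {1..n}"
    using assms by auto
  have D: "proj_mat n 2 = ?D"
    unfolding proj_mat_eq_partial_id by (rule partial_id_cong) auto
  have img: "Transposition.transpose 2 i ` Transposition.transpose 1 (Suc i) ` (- {1, 2})
      = - {i} \<inter> - {Suc i}"
  proof -
    have "Transposition.transpose 2 i ` Transposition.transpose 1 (Suc i) ` {1, 2} = {i, Suc i}"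
      using assms by (auto simp: Transposition.transpose_def)
    then show ?thesis
      by (auto simp: bij_image_Compl_eq[OF bij_transpose])
  qed
  have "?T * ?S * ?D * ?S * ?T = ?T * (?S * ?D * ?S) * ?T"
    by (simp add: assoc_mult_mat[of _ n n _ n _ n] mult_carrier_mat[of _ n n _ n])
  also have "\<dots> = partial_id n (- {i} \<inter> - {Suc i})"
    by (simp only: transp_mat_conj_partial_id[OF mem(1,2)] transp_mat_conj_partial_id[OF mem(3,4)] img)
  finally show ?thesis
    by (simp add: JM_Q_def erase_def alg_transp_def alg_P_def D alg_mult_single
        partial_id_times)
qed


section \<open>Standard tableaux\<close>

lemma std_tableaux_inj: "L \<in> std_tableaux n lam \<Longrightarrow> inj_on L (diagram lam)"
  by (simp add: std_tableaux_def)

lemma box_of_apply: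
  "inj_on L (diagram lam) \<Longrightarrow> b \<in> diagram lam \<Longrightarrow> box_of lam L (L b) = b"
  by (simp add: box_of_def the_inv_into_f_f)

lemma entriesE:
  assumes "i \<in> entries lam L"
  obtains b where "b \<in> diagram lam" "L b = i"
  using assms by (auto simp: entries_def)

lemma entries_swap_entries:
  "entries lam (swap_entries lam i L) = Transposition.transpose i (i + 1) ` entries lam L"
  by (auto simp: entries_def swap_entries_def)

lemma mem_entries_swap_entries [simp]:
  "i \<in> entries lam (swap_entries lam i L) \<longleftrightarrow> Suc i \<in> entries lam L"
  "Suc i \<in> entries lam (swap_entries lam i L) \<longleftrightarrow> i \<in> entries lam L"
  by (auto simp: entries_swap_entries image_iff Transposition.transpose_def split: if_splits)

lemma inj_on_swap_entries:
  assumes "inj_on L (diagram lam)"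
  shows "inj_on (swap_entries lam i L) (diagram lam)"
  unfolding swap_entries_def inj_on_restrict_eq
  using comp_inj_on[OF assms inj_on_subset[OF inj_on_transpose subset_UNIV]] by (simp add: comp_def)

lemma box_of_swap_entries:
  assumes "inj_on L (diagram lam)" and "Suc i \<in> entries lam L"
  shows "box_of lam (swap_entries lam i L) i = box_of lam L (Suc i)"
proof -
  from assms(2) obtain b where b: "b \<in> diagram lam" "L b = Suc i" by (rule entriesE)
  have "inj_on (swap_entries lam i L) (diagram lam)"
    by (rule inj_on_swap_entries[OF assms(1)])
  moreover have "swap_entries lam i L b = i" using b by (simp add: swap_entries_def)
  ultimately show ?thesis
    using box_of_apply[of "swap_entries lam i L" lam b] box_of_apply[OF assms(1) b(1)] b by simp
qed

lemma swap_entries_idem: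
  assumes "L \<in> std_tableaux n lam" "i \<notin> entries lam L" "Suc i \<notin> entries lam L"
  shows "swap_entries lam i L = L"
proof
  fix b
  show "swap_entries lam i L b = L b"
  proof (cases "b \<in> diagram lam")
    case True
    then have "L b \<noteq> i" "L b \<noteq> Suc i" using assms(2,3) by (metis entries_def imageI)+
    with True show ?thesis by (simp add: swap_entries_def)
  next
    case False
    with assms(1) show ?thesis
      by (cases b) (auto simp: swap_entries_def std_tableaux_def PiE_def extensional_def)
  qed
qed

lemma swap_entries_involution:
  assumes "L \<in> std_tableaux n lam"
  shows "swap_entries lam i (swap_entries lam i L) = L"
  using assms by (auto simp: fun_eq_iff swap_entries_def std_tableaux_def PiE_def extensional_def)

text \<open>The transposition of \<open>i\<close> and \<open>i + 1\<close> is strictly increasing on any set of numbers that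
  does not contain both.\<close>

lemma swap_entries_std:
  assumes L: "L \<in> std_tableaux n lam" and i: "1 \<le> i" "i < n"
    and not_both: "\<not> (i \<in> entries lam L \<and> Suc i \<in> entries lam L)"
  shows "swap_entries lam i L \<in> std_tableaux n lam"
proof -
  let ?t = "Transposition.transpose i (i + 1)"
  have mono: "?t (L b) < ?t (L b')"
    if "b \<in> diagram lam" "b' \<in> diagram lam" "L b < L b'" for b b'
  proof -
    have "\<not> (L b = i \<and> L b' = Suc i)" using that not_both by (metis entries_def imageI)
    then show ?thesis using that(3) by (auto simp: Transposition.transpose_def)
  qed
  have "?t (L b) \<in> {1..n}" if "b \<in> diagram lam" for b
  proof -
    have "L b \<in> {1..n}" using L that by (auto simp: std_tableaux_def)
    then show ?thesis using i by (auto simp: Transposition.transpose_def)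
  qed
  moreover have "inj_on (swap_entries lam i L) (diagram lam)"
    by (rule inj_on_swap_entries[OF std_tableaux_inj[OF L]])
  ultimately show ?thesis
    using L mono unfolding std_tableaux_def by (auto simp: swap_entries_def)
qed

text \<open>On a common diagonal one box would lie strictly below and to the right of the other. The
  corner of the diagram between them would then carry an entry strictly between \<open>i\<close> and
  \<open>i + 1\<close>. Hence the denominator of the seminormal coefficient does not vanish.\<close>

lemma content_box_of_Suc_neq:
  assumes L: "L \<in> std_tableaux n lam"
    and i: "i \<in> entries lam L" "Suc i \<in> entries lam L"
  shows "content (box_of lam L (Suc i)) \<noteq> content (box_of lam L i)"
proof
  assume eq: "content (box_of lam L (Suc i)) = content (box_of lam L i)"
  obtain x y where xy: "(x, y) \<in> diagram lam" "L (x, y) = i"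
    using entriesE[OF i(1)] by (metis surj_pair)
  obtain x' y' where xy': "(x', y') \<in> diagram lam" "L (x', y') = Suc i"
    using entriesE[OF i(2)] by (metis surj_pair)
  have rows: "\<And>x y y'. (x, y) \<in> diagram lam \<Longrightarrow> (x, y') \<in> diagram lam \<Longrightarrow> y < y' \<Longrightarrow> L (x, y) < L (x, y')"
    and cols: "\<And>x x' y. (x, y) \<in> diagram lam \<Longrightarrow> (x', y) \<in> diagram lam \<Longrightarrow> x < x' \<Longrightarrow> L (x, y) < L (x', y)"
    using L unfolding std_tableaux_def by blast+
  have "int y' - int x' = int y - int x"
    using eq box_of_apply[OF std_tableaux_inj[OF L] xy(1)]
      box_of_apply[OF std_tableaux_inj[OF L] xy'(1)] xy(2) xy'(2) by (simp add: content_def)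
  moreover have "(x, y) \<noteq> (x', y')" using xy xy' by auto
  ultimately consider "x < x'" "y < y'" | "x' < x" "y' < y" by force
  then show False
  proof cases
    case 1
    then have corner: "(x', y) \<in> diagram lam" using xy xy' by (auto simp: diagram_def)
    have "L (x, y) < L (x', y)" "L (x', y) < L (x', y')"
      using rows cols corner xy xy' 1 by blast+
    with xy xy' show False by simp
  next
    case 2
    then have corner: "(x, y') \<in> diagram lam" using xy xy' by (auto simp: diagram_def)
    have "L (x', y') < L (x, y')" "L (x, y') < L (x, y)"
      using rows cols corner xy xy' 2 by blast+
    with xy xy' show False by simp
  qed
qed

text \<open>Nothing can stand to the left of or above the smallest possible entry, so it sits in the
  corner box.\<close>

lemma content_box_of_1:
  assumes lam: "sorted_wrt (\<ge>) lam" and L: "L \<in> std_tableaux n lam" and "1 \<in> entries lam L"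
  shows "content (box_of lam L 1) = 0"
proof -
  obtain x y where xy: "(x, y) \<in> diagram lam" "L (x, y) = 1"
    using entriesE[OF assms(3)] by (metis surj_pair)
  have pos: "1 \<le> L b" if "b \<in> diagram lam" for b
    using L that by (auto simp: std_tableaux_def)
  have "x = 1"
  proof (rule ccontr)
    assume "x \<noteq> 1"
    then have x: "1 \<le> x - 1" "x - 1 < x" "x \<le> length lam" using xy by (auto simp: diagram_def)
    then have "lam ! (x - 1) \<le> lam ! (x - 1 - 1)"
      using sorted_wrt_nth_less[OF lam, of "x - 1 - 1" "x - 1"] by simp
    then have up: "(x - 1, y) \<in> diagram lam" using xy x by (auto simp: diagram_def)
    then have "L (x - 1, y) < L (x, y)"
      using L xy(1) x(2) unfolding std_tableaux_def by blast
    with pos[OF up] xy(2) show False by simp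
  qed
  moreover have "y = 1"
  proof (rule ccontr)
    assume "y \<noteq> 1"
    then have y: "1 \<le> y - 1" "y - 1 < y" using xy by (auto simp: diagram_def)
    then have left: "(x, y - 1) \<in> diagram lam" using xy by (auto simp: diagram_def)
    then have "L (x, y - 1) < L (x, y)"
      using L xy(1) y(2) unfolding std_tableaux_def by blast
    with pos[OF left] xy(2) show False by simp
  qed
  ultimately show ?thesis
    using box_of_apply[OF std_tableaux_inj[OF L] xy(1)] xy(2) by (simp add: content_def)
qed


section \<open>The action\<close>

context rook_rep
begin

lemma basis_vec_V: "L \<in> std_tableaux n lam \<Longrightarrow> basis_vec L \<in> V_space n lam"
  by (simp add: V_space_def basis_vec_def)

lemma zero_V: "0 \<in> V_space n lam"
  by (simp add: V_space_def)

lemma lin_scale_V: "u \<in> V_space n lam \<Longrightarrow> lin_scale c u \<in> V_space n lam"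
  using keys_lin_scale[of c u] by (auto simp: V_space_def)

lemma act_zero_right: "f \<in> rook_algebra n \<Longrightarrow> act f 0 = 0"
  using act_scale_right[of f 0 0] zero_V by simp

lemma act_zero_left: "u \<in> V_space n lam \<Longrightarrow> act 0 u = 0"
  using act_scale_left[of 0 u 0] zero_rook_algebra by simp

lemma act_diff_left:
  "f \<in> rook_algebra n \<Longrightarrow> g \<in> rook_algebra n \<Longrightarrow> u \<in> V_space n lam \<Longrightarrow>
     act (f - g) u = act f u - act g u"
  by (simp add: diff_eq_add_lin_scale act_add_left act_scale_left lin_scale_rook_algebra)

lemma act_s_involution:
  assumes "1 \<le> i" "i < n" "u \<in> V_space n lam"
  shows "act (alg_s n i) (act (alg_s n i) u) = u"
  using assms act_mult[of "alg_s n i" "alg_s n i" u]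
  by (simp add: alg_s_involution alg_s_rook_algebra act_one)

lemma act_s_not_both:
  assumes "L \<in> std_tableaux n lam" "1 \<le> i" "i < n"
    and "\<not> (i \<in> entries lam L \<and> Suc i \<in> entries lam L)"
  shows "act (alg_s n i) (basis_vec L) = basis_vec (swap_entries lam i L)"
proof (cases "i \<in> entries lam L \<longleftrightarrow> Suc i \<in> entries lam L")
  case True
  then have none: "i \<notin> entries lam L" "Suc i \<notin> entries lam L" using assms(4) by auto
  then show ?thesis
    using act_s_no_entry[OF assms(1-3)] swap_entries_idem[OF assms(1) none] by simp
next
  case False
  then show ?thesis using act_s_one_entry[OF assms(1-3)] by simp
qed

lemma act_conj_s:
  assumes "f \<in> rook_algebra n" "u \<in> V_space n lam"
  shows "act (alg_s n i \<star> f \<star> alg_s n i) u = act (alg_s n i) (act f (act (alg_s n i) u))"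
  using assms by (simp add: act_mult act_closed rook_algebra_intros)

text \<open>The eigenvalue at \<open>s\<^sub>i L\<close> is transported to \<open>L\<close>, because \<open>s\<^sub>i\<close> takes \<open>v\<^sub>L\<close> to the
  single basis vector of \<open>s\<^sub>i L\<close> and back.\<close>

lemma act_conj_s_not_both:
  assumes L: "L \<in> std_tableaux n lam" and i: "1 \<le> i" "i < n"
    and not_both: "\<not> (i \<in> entries lam L \<and> Suc i \<in> entries lam L)"
    and f: "f \<in> rook_algebra n"
    and eigen: "act f (basis_vec (swap_entries lam i L)) =
                  lin_scale c (basis_vec (swap_entries lam i L))"
  shows "act (alg_s n i \<star> f \<star> alg_s n i) (basis_vec L) = lin_scale c (basis_vec L)"
proof -
  note std = swap_entries_std[OF L i not_both]
  have "act (alg_s n i) (basis_vec (swap_entries lam i L)) = basis_vec L"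
    using act_s_not_both[OF std i] not_both swap_entries_involution[OF L] by auto
  then show ?thesis
    using L f act_s_not_both[OF L i not_both] basis_vec_V[OF std]
    by (simp add: act_conj_s basis_vec_V eigen act_scale_right alg_s_rook_algebra)
qed

text \<open>One induction step serves \<open>X\<^sub>i\<close>, with eigenvalues \<open>c = 1, d = 0\<close>, and the erasing
  matrices, with \<open>c = 0, d = 1\<close>. If \<open>i\<close> and \<open>i + 1\<close> are both entries of \<open>L\<close>, they are so in
  both tableaux that occur in \<open>s\<^sub>i v\<^sub>L\<close>; \<open>f\<close> therefore scales \<open>s\<^sub>i v\<^sub>L\<close> by \<open>c\<close>, and a second
  application of \<open>s\<^sub>i\<close> restores \<open>v\<^sub>L\<close>.\<close>

lemma act_conj_s_indicator:
  assumes f: "f \<in> rook_algebra n" and i: "1 \<le> i" "i < n"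
    and eigen: "\<And>L. L \<in> std_tableaux n lam \<Longrightarrow>
      act f (basis_vec L) = lin_scale (if i \<in> entries lam L then c else d) (basis_vec L)"
    and L: "L \<in> std_tableaux n lam"
  shows "act (alg_s n i \<star> f \<star> alg_s n i) (basis_vec L)
       = lin_scale (if Suc i \<in> entries lam L then c else d) (basis_vec L)"
proof (cases "i \<in> entries lam L \<and> Suc i \<in> entries lam L")
  case False
  show ?thesis
    by (rule act_conj_s_not_both[OF L i False f])
       (simp add: eigen swap_entries_std[OF L i False])
next
  case True
  define a where "a = seminormal_coeff lam L i"
  define w where "w = (if swap_entries lam i L \<in> std_tableaux n lam
    then basis_vec (swap_entries lam i L) else 0)"
  have s: "act (alg_s n i) (basis_vec L) = lin_scale a (basis_vec L) + lin_scale (1 + a) w"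
    using act_s_both_entries[OF L i] True by (simp add: a_def w_def)
  have V: "basis_vec L \<in> V_space n lam" "w \<in> V_space n lam"
    using L by (auto simp: w_def basis_vec_V zero_V)
  have fw: "act f w = lin_scale c w"
    using True f by (simp add: w_def eigen act_zero_right)
  have "act f (act (alg_s n i) (basis_vec L)) = lin_scale c (act (alg_s n i) (basis_vec L))"
    unfolding s using True V f
    by (simp add: act_add_right act_scale_right lin_scale_V eigen[OF L] fw)
       (rule poly_mapping_eqI, simp add: lookup_add algebra_simps)
  then show ?thesis
    using True V f i
    by (simp add: act_conj_s act_scale_right act_closed alg_s_rook_algebra act_s_involution)
qed

lemma act_JM_X:
  assumes "L \<in> std_tableaux n lam" "1 \<le> i" "i \<le> n"
  shows "act (JM_X n i) (basis_vec L)
       = lin_scale (if i \<in> entries lam L then 1 else 0) (basis_vec L)"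
  using assms(2,3,1)
proof (induction i arbitrary: L rule: dec_induct)
  case base
  then show ?case
    by (simp add: act_diff_left act_one act_P1[simplified] basis_vec_V rook_algebra_intros)
next
  case (step i)
  then obtain k where k: "i = Suc k" by (cases i) auto
  show ?case
    using act_conj_s_indicator[OF JM_X_rook_algebra[of n i], of i 1 0] step by (simp add: k)
qed

lemma act_erase:
  assumes "L \<in> std_tableaux n lam" "1 \<le> i" "i \<le> n"
  shows "act (erase n i) (basis_vec L)
       = lin_scale (if i \<in> entries lam L then 0 else 1) (basis_vec L)"
  using assms(2,3,1)
proof (induction i arbitrary: L rule: dec_induct)
  case base
  then show ?case unfolding erase_1 by (simp add: act_P1[simplified])
next
  case (step i)
  then show ?case
    using act_conj_s_indicator[OF erase_rook_algebra[of n i], of i 0 1]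
    by (simp add: erase_Suc)
qed

lemma act_JM_gamma:
  assumes "L \<in> std_tableaux n lam" "1 \<le> i" "i \<le> n"
  shows "act (JM_gamma n i) (basis_vec L)
       = lin_scale (if i \<in> entries lam L then 0 else 1) (basis_vec L)"
  using assms act_JM_X[OF assms] unfolding JM_gamma_def
  by (simp add: act_diff_left act_one basis_vec_V rook_algebra_intros)

lemma act_JM_Q:
  assumes "L \<in> std_tableaux n lam" "1 \<le> i" "i < n"
  shows "act (JM_Q n (Suc i)) (basis_vec L)
       = lin_scale (if i \<in> entries lam L \<or> Suc i \<in> entries lam L then 0 else 1) (basis_vec L)"
  using assms
  by (simp add: JM_Q_eq_erase_mult act_mult erase_rook_algebra basis_vec_V act_erase
      act_zero_right)

lemma act_JM_Xt_Suc:
  assumes i: "1 \<le> i" "i < n" and u: "u \<in> V_space n lam"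
  shows "act (JM_Xt n (Suc i)) u
       = act (alg_s n i) (act (JM_Xt n i) (act (alg_s n i) u)) + act (alg_s n i) u
         - act (alg_s n i) (act (JM_gamma n i) u) - act (JM_gamma n i) (act (alg_s n i) u)
         + act (JM_Q n (Suc i)) u"
proof -
  obtain k where "i = Suc k" using i by (cases i) auto
  then show ?thesis
    using u by (simp add: act_add_left act_diff_left act_conj_s[simplified] act_mult act_closed rook_algebra_intros)
qed

text \<open>If \<open>i\<close> and \<open>i + 1\<close> are both present, \<open>w\<close> stands for
  \<open>v\<^bsub>L'\<^esub>\<close>, which is \<open>0\<close> when \<open>s\<^sub>i L\<close> is not standard; since \<open>0\<close> is an eigenvector for
  every eigenvalue, the same computation covers that case.\<close>

lemma act_JM_Xt:
  assumes lam: "sorted_wrt (\<ge>) lam" and "L \<in> std_tableaux n lam" "1 \<le> i" "i \<le> n"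
  shows "act (JM_Xt n i) (basis_vec L)
       = lin_scale (if i \<in> entries lam L then of_int (content (box_of lam L i)) else 0)
           (basis_vec L)"
  using assms(3,4,2)
proof (induction i arbitrary: L rule: dec_induct)
  case base
  then show ?case
    using content_box_of_1[OF lam base(2)] by (simp add: act_zero_left basis_vec_V)
next
  case (step i)
  then have i: "1 \<le> i" "i < n" and L: "L \<in> std_tableaux n lam" by auto
  note IH = step.IH[OF less_imp_le[OF i(2)]]
  note v = basis_vec_V[OF L]
  note gamma = act_JM_gamma[OF _ i(1) less_imp_le[OF i(2)]]
  note Q = act_JM_Q[OF L i]
  show ?case
  proof (cases "i \<in> entries lam L \<and> Suc i \<in> entries lam L")
    case False
    note std = swap_entries_std[OF L i False]
    note s = act_s_not_both[OF L i False]
    have "act (alg_s n i \<star> JM_Xt n i \<star> alg_s n i) (basis_vec L)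
        = lin_scale (if Suc i \<in> entries lam L then of_int (content (box_of lam L (Suc i))) else 0)
            (basis_vec L)"
      by (rule act_conj_s_not_both[OF L i False JM_Xt_rook_algebra])
         (simp add: IH[OF std] box_of_swap_entries[OF std_tableaux_inj[OF L]])
    then have conj: "act (alg_s n i) (act (JM_Xt n i) (act (alg_s n i) (basis_vec L))) = \<dots>"
      using act_conj_s[OF JM_Xt_rook_algebra v] by simp
    \<comment> \<open>what remains of the recursion cancels: with exactly one of the two entries present,
       \<open>s\<^sub>i v\<^sub>L\<close> is removed by one of the two \<open>\<gamma>\<close> terms; with neither, \<open>1 - 1 - 1 + 1 = 0\<close>\<close>
    show ?thesis
      unfolding act_JM_Xt_Suc[OF i v] s conj[unfolded s] gamma[OF L] Q gamma[OF std]
      using False swap_entries_idem[OF L, of i]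
      by (auto simp: s act_zero_right alg_s_rook_algebra)
  next
    case True
    define c d where "c = (of_int (content (box_of lam L i)) :: complex)"
      and "d = (of_int (content (box_of lam L (Suc i))) :: complex)"
    define a where "a = seminormal_coeff lam L i"
    have cd: "d - c \<noteq> 0"
      using content_box_of_Suc_neq[OF L] True by (simp add: c_def d_def)
    have a: "a = 1 / (d - c)" by (simp add: a_def seminormal_coeff_def c_def d_def)
    define w where "w = (if swap_entries lam i L \<in> std_tableaux n lam
      then basis_vec (swap_entries lam i L) else 0)"
    define sv where "sv = act (alg_s n i) (basis_vec L)"
    have sv: "sv = lin_scale a (basis_vec L) + lin_scale (1 + a) w"
      using act_s_both_entries[OF L i] True by (simp add: sv_def a_def w_def)
    have wV: "w \<in> V_space n lam" by (simp add: w_def basis_vec_V zero_V)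
    have svV: "sv \<in> V_space n lam" by (simp add: sv_def act_closed alg_s_rook_algebra v)
    have Xw: "act (JM_Xt n i) w = lin_scale d w"
      using True IH by (simp add: w_def d_def box_of_swap_entries[OF std_tableaux_inj[OF L]]
          act_zero_right JM_Xt_rook_algebra)
    have "act (JM_Xt n i) sv = lin_scale a (lin_scale c (basis_vec L)) + lin_scale (1 + a) (lin_scale d w)"
      unfolding sv using True
      by (simp add: act_add_right act_scale_right lin_scale_V v wV JM_Xt_rook_algebra Xw IH[OF L] c_def)
    also have "\<dots> = lin_scale d sv + lin_scale (- 1) (basis_vec L)"
    proof (rule poly_mapping_eqI)
      fix K
      \<comment> \<open>comparison of the coefficients of \<open>v\<^sub>L\<close>; those of \<open>w\<close> agree identically\<close>
      have "a * d = 1 + a * c" using cd by (simp add: a field_simps)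
      then have shift: "a * (d * z) = z + a * (c * z)" for z
        by (simp add: distrib_right flip: mult.assoc)
      show "Poly_Mapping.lookup (lin_scale a (lin_scale c (basis_vec L)) + lin_scale (1 + a) (lin_scale d w)) K
          = Poly_Mapping.lookup (lin_scale d sv + lin_scale (- 1) (basis_vec L)) K"
        unfolding sv by (simp add: lookup_add algebra_simps) (simp add: shift)
    qed
    \<comment> \<open>apply \<open>s\<^sub>i\<close> once more, using \<open>s\<^sub>i s\<^sub>i v\<^sub>L = v\<^sub>L\<close>; the term \<open>- s\<^sub>i v\<^sub>L\<close> cancels in the recursion\<close>
    finally have "act (alg_s n i) (act (JM_Xt n i) sv) = lin_scale d (basis_vec L) + lin_scale (- 1) sv"
      using i v svV
      by (simp add: act_add_right act_scale_right lin_scale_V alg_s_rook_algebra)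
         (simp add: sv_def act_s_involution)
    moreover have "act (JM_gamma n i) sv = 0"
      unfolding sv using True v wV
      by (simp add: act_add_right act_scale_right lin_scale_V JM_gamma_rook_algebra gamma[OF L])
         (simp add: w_def gamma act_zero_right JM_gamma_rook_algebra)
    ultimately show ?thesis
      unfolding act_JM_Xt_Suc[OF i v] sv_def[symmetric] gamma[OF L] Q
      using True by (simp add: act_zero_right alg_s_rook_algebra flip: d_def diff_eq_add_lin_scale)
  qed
qed

end

theorem theorem2p10:
  fixes n i :: nat and lam :: "nat list" and L :: filling
    and act :: "(int mat \<Rightarrow>\<^sub>0 complex) \<Rightarrow> (filling \<Rightarrow>\<^sub>0 complex) \<Rightarrow> (filling \<Rightarrow>\<^sub>0 complex)"
  assumes "1 \<le> n"
    and "lam \<in> partitions_upto n"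
    and "rook_rep n lam act"
    and "L \<in> std_tableaux n lam"
    and "1 \<le> i" and "i \<le> n"
  shows "act (JM_X n i) (basis_vec L) = (if i \<in> entries lam L then basis_vec L else 0) \<and>
         act (JM_Xt n i) (basis_vec L) =
           (if i \<in> entries lam L
            then lin_scale (of_int (content (box_of lam L i))) (basis_vec L) else 0)"
proof -
  have "sorted_wrt (\<ge>) lam" using assms(2) by (simp add: partitions_upto_def)
  then show ?thesis
    using rook_rep.act_JM_X[OF assms(3-6)] rook_rep.act_JM_Xt[OF assms(3) _ assms(4-6)] by simp
qed

end
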